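(* Let $n\ge1$ and let $\mathcal{G}=\{(x,w)\in[-1,1]^n\times\mathbb{R}\mid w=\prod_{j=1}^n x_j\}$. Partition the subsets of $\{1,\dots,n\}$ into $\mathcal{N}^{even}:=\{I\subseteq\{1,\dots,n\}\mid |I|\text{ is even}\}$ and $\mathcal{N}^{odd}:=\{I\subseteq\{1,\dots,n\}\mid|I|\text{ is odd}\}$. If $n$ is odd, then $$\operatorname{conv}\mathcal{G}=\Big\{(x,w)\in[-1,1]^{n+1}\;\Big|\;-(n-1)\le\sum_{i\in I}x_i-\sum_{i\notin I}x_i+w\le n-1\ \ \text{for all } I\in\mathcal{N}^{even}\Big\}.$$ If $n$ is even, then $$\operatorname{conv}\mathcal{G}=\Big\{(x,w)\in[-1,1]^{n+1}\;\Big|\;\sum_{i\in I}x_i-\sum_{i\notin I}x_i+w\le n-1\ \ \text{for all } I\in\mathcal{N}^{odd},\quad \sum_{i\in I}x_i-\sum_{i\notin I}x_i+w\ge-(n-1)\ \ \text{for all } I\in\mathcal{N}^{even}\Big\}.$$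
   Context: $\operatorname{conv}$ denotes the convex hull in $\mathbb{R}^{n+1}$; $\sum_{i\notin I}$ means the sum over $i\in\{1,\dots,n\}\setminus I$. *)

theory Defs
  imports "HOL-Analysis.Analysis"
begin

text \<open>The ambient space of dimension \<open>n + 1\<close> is \<open>(real ^ 'n) \<times> real\<close>, with \<open>n = CARD('n)\<close> and
  the type \<open>'n\<close> in the role of the index set \<open>{1,\<dots>,n}\<close>; \<open>n \<ge> 1\<close> holds because types are
  nonempty.\<close>

definition prod_graph :: "((real ^ 'n) \<times> real) set" where
  "prod_graph = {(x, w). (\<forall>i. x $ i \<in> {-1..1}) \<and> w = (\<Prod>j\<in>UNIV. x $ j)}"

definition N_even :: "'n::finite set set" where
  "N_even = {I. even (card I)}"

definition N_odd :: "'n::finite set set" where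
  "N_odd = {I. odd (card I)}"

end

theory Submission
  imports Defs
begin

text \<open>The vertices of the hull are the points of \<open>{-1,1}\<^sup>n\<^sup>+\<^sup>1\<close> whose coordinates have product 1, and
  the inequalities cut off each vertex \<open>s\<close> of the other parity by \<open>s \<bullet> y \<le> n - 1\<close>.
  By separation it is enough to bound every linear functional \<open>c\<close> on the right-hand side by its
  maximum over the vertices. Let \<open>s\<close> be the sign vector of \<open>c\<close>. If \<open>s\<close> is a vertex, this maximum is
  \<open>\<Sum>\<bar>c\<^sub>i\<bar>\<close> and the box constraints suffice. Otherwise flip the sign at a coordinate where
  \<open>m = min \<bar>c\<^sub>i\<bar>\<close> is attained: the maximum is at least \<open>\<Sum>\<bar>c\<^sub>i\<bar> - 2m\<close>, while
  \<open>c \<bullet> y = \<Sum>(\<bar>c\<^sub>i\<bar> - m) s\<^sub>i y\<^sub>i + m (s \<bullet> y) \<le> \<Sum>\<bar>c\<^sub>i\<bar> - (n + 1) m + m (n - 1)\<close>.\<close>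

definition sign_vec :: "'n set \<Rightarrow> real ^ 'n" where
  "sign_vec I = (\<chi> i. if i \<in> I then 1 else -1)"

text \<open>The vectors \<open>(sign_vec I, - (\<Prod>i\<in>UNIV. sign_vec I $ i))\<close> are
  exactly the points of {-1,1}^(n+1) with coordinate product -1, so one family of constraints serves
  both parities of n.\<close>

definition box_parity_polytope :: "((real ^ 'n) \<times> real) set" where
  "box_parity_polytope = {(x, w). (\<forall>i. x $ i \<in> {-1..1}) \<and> w \<in> {-1..1} \<and>
     (\<forall>I. sign_vec I \<bullet> x - (\<Prod>i\<in>UNIV. sign_vec I $ i) * w \<le> real CARD('n) - 1)}"

lemma sign_vec_nth: "sign_vec I $ i = (if i \<in> I then 1 else -1)"
  by (simp add: sign_vec_def)

lemma sign_vec_inner: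
  fixes x :: "real ^ 'n"
  shows "sign_vec I \<bullet> x = (\<Sum>i\<in>I. x $ i) - (\<Sum>i\<in>UNIV - I. x $ i)"
proof -
  have "sign_vec I \<bullet> x = (\<Sum>i\<in>I. sign_vec I $ i * x $ i) + (\<Sum>i\<in>UNIV - I. sign_vec I $ i * x $ i)"
    by (simp add: inner_vec_def sum.subset_diff[of I UNIV] add.commute)
  then show ?thesis
    by (simp add: sign_vec_nth sum_negf)
qed

lemma sign_vec_Compl: "sign_vec (- I) = - sign_vec I"
  by (simp add: vec_eq_iff sign_vec_nth)

lemma prod_sign_vec: "(\<Prod>i\<in>UNIV. sign_vec I $ i) = (-1) ^ card (- I)"
proof -
  have "(\<Prod>i\<in>UNIV. sign_vec I $ i) = (\<Prod>i\<in>I. sign_vec I $ i) * (\<Prod>i\<in>- I. sign_vec I $ i)"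
    by (simp add: prod.subset_diff[of I UNIV] Compl_eq_Diff_UNIV mult.commute)
  then show ?thesis
    by (simp add: sign_vec_nth)
qed

text \<open>Induction on \<open>A\<close>: with \<open>P = prod y A\<close>,
  \<open>0 \<le> (1 - P) * (1 - y a)\<close> says \<open>y a - P * y a \<le> 1 - P\<close>, so
  inserting \<open>a\<close> raises the left side by at most 1.\<close>

lemma sum_minus_prod_le:
  fixes y :: "'a \<Rightarrow> real"
  assumes "finite A" "A \<noteq> {}" "\<And>i. i \<in> A \<Longrightarrow> \<bar>y i\<bar> \<le> 1"
  shows "sum y A - prod y A \<le> real (card A) - 1"
  using assms
proof (induction rule: finite_ne_induct)
  case (singleton a)
  then show ?case by simp
next
  case (insert a A)
  have "\<bar>prod y A\<bar> \<le> 1"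
    using insert.prems by (simp add: abs_prod prod_le_1)
  moreover have "\<bar>y a\<bar> \<le> 1"
    using insert.prems by simp
  ultimately have "0 \<le> (1 - prod y A) * (1 - y a)"
    by (intro mult_nonneg_nonneg) auto
  moreover have "sum y A - prod y A \<le> real (card A) - 1"
    using insert by simp
  ultimately show ?case
    using insert.hyps by (simp add: algebra_simps)
qed

lemma prod_graph_subset_polytope:
  "(prod_graph :: ((real ^ 'n) \<times> real) set) \<subseteq> box_parity_polytope"
proof clarify
  fix x :: "real ^ 'n" and w
  assume "(x, w) \<in> prod_graph"
  then have x: "\<And>i. \<bar>x $ i\<bar> \<le> 1" and w: "w = (\<Prod>i\<in>UNIV. x $ i)"
    by (auto simp: prod_graph_def abs_le_iff)
  have "\<bar>w\<bar> \<le> 1"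
    unfolding w using x by (simp add: abs_prod prod_le_1)
  \<comment> \<open>For \<open>y i = sign_vec I $ i * x $ i\<close> the product of all
    \<open>y i\<close> is the product of the signs times \<open>w\<close>.\<close>
  moreover have "sign_vec I \<bullet> x - (\<Prod>i\<in>UNIV. sign_vec I $ i) * w \<le> real CARD('n) - 1" for I
    using sum_minus_prod_le[of UNIV "\<lambda>i. sign_vec I $ i * x $ i"] x
    by (simp add: inner_vec_def w prod.distrib abs_mult sign_vec_nth)
  ultimately show "(x, w) \<in> box_parity_polytope"
    using x by (auto simp: box_parity_polytope_def abs_le_iff)
qed

lemma convex_box_parity_polytope:
  "convex (box_parity_polytope :: ((real ^ 'n) \<times> real) set)"
proof -
  have halfspaces: "box_parity_polytope =
      (\<Inter>i. {p. (axis i 1, 0) \<bullet> p \<le> 1} \<inter> {p. (axis i 1, 0) \<bullet> p \<ge> -1})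
      \<inter> {p. (0 :: real ^ 'n, 1) \<bullet> p \<le> 1} \<inter> {p. (0, 1) \<bullet> p \<ge> -1}
      \<inter> (\<Inter>I. {p. (sign_vec I, - (\<Prod>i\<in>UNIV. sign_vec I $ i)) \<bullet> p \<le> real CARD('n) - 1})"
    by (auto simp: box_parity_polytope_def inner_axis')
  show ?thesis
    unfolding halfspaces
    by (intro convex_Int convex_INT convex_halfspace_le convex_halfspace_ge)
qed

lemma sign_vec_in_prod_graph: "(sign_vec I, \<Prod>i\<in>UNIV. sign_vec I $ i) \<in> prod_graph"
  by (simp add: prod_graph_def sign_vec_nth)

lemma polytope_functional_le:
  fixes a x :: "real ^ 'n"
  assumes vertex: "\<And>I. a \<bullet> sign_vec I + b * (\<Prod>i\<in>UNIV. sign_vec I $ i) \<le> M"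
    and "(x, w) \<in> box_parity_polytope"
  shows "a \<bullet> x + b * w \<le> M"
proof -
  have x: "\<And>i. \<bar>x $ i\<bar> \<le> 1" and w: "\<bar>w\<bar> \<le> 1"
    and facet: "\<And>I. sign_vec I \<bullet> x - (\<Prod>i\<in>UNIV. sign_vec I $ i) * w \<le> real CARD('n) - 1"
    using assms(2) by (auto simp: box_parity_polytope_def abs_le_iff)
  define I where "I = {i. a $ i \<ge> 0}"
  define e where "e = (\<Prod>i\<in>UNIV. sign_vec I $ i)"
  have sgn: "\<And>i. a $ i * sign_vec I $ i = \<bar>a $ i\<bar>"
    by (simp add: I_def sign_vec_nth)
  then have inner_I: "a \<bullet> sign_vec I = (\<Sum>i\<in>UNIV. \<bar>a $ i\<bar>)"
    by (simp add: inner_vec_def)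
  have e: "e = 1 \<or> e = -1"
    unfolding e_def prod_sign_vec by (metis neg_one_even_power neg_one_odd_power)
  show ?thesis
  \<comment> \<open>If \<open>b * e \<ge> 0\<close>, the vertex \<open>(sign_vec I, e)\<close>
    agrees in sign with \<open>(a, b)\<close>; otherwise the sign vector of \<open>(a, b)\<close> is
    \<open>(sign_vec I, - e)\<close>, which is not a vertex.\<close>
  proof (cases "b * e \<ge> 0")
    case True
    then have be: "b * e = \<bar>b\<bar>"
      using e by auto
    have "a \<bullet> x \<le> (\<Sum>i\<in>UNIV. \<bar>a $ i\<bar>)"
      unfolding inner_vec_def
    proof (rule sum_mono)
      fix i
      have "\<bar>a $ i * x $ i\<bar> \<le> \<bar>a $ i\<bar>"
        using x[of i] by (simp add: abs_mult mult_left_le)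
      then show "a $ i \<bullet> x $ i \<le> \<bar>a $ i\<bar>" by simp
    qed
    moreover have "\<bar>b * w\<bar> \<le> \<bar>b\<bar>"
      using w by (simp add: abs_mult mult_left_le)
    ultimately show ?thesis
      using vertex[of I] be inner_I unfolding e_def by linarith
  next
    case False
    then have be: "b * e = - \<bar>b\<bar>"
      using e by auto
    define m where "m = Min (insert \<bar>b\<bar> (range (\<lambda>i. \<bar>a $ i\<bar>)))"
    have m: "m \<in> insert \<bar>b\<bar> (range (\<lambda>i. \<bar>a $ i\<bar>))"
      unfolding m_def by (rule Min_in) auto
    have m_b: "m \<le> \<bar>b\<bar>" and m_a: "\<And>i. m \<le> \<bar>a $ i\<bar>"
      unfolding m_def by (simp_all add: Min_le min.coboundedI2)
    have "m \<ge> 0"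
      using m by auto
    have "(\<Sum>i\<in>UNIV. \<bar>a $ i\<bar>) + \<bar>b\<bar> - 2 * m \<le> M"
    \<comment> \<open>Flipping the last coordinate gives the vertex over \<open>I\<close>. Flipping
      a coordinate \<open>k\<close> of \<open>sign_vec I\<close> instead turns the product of signs
      into \<open>- e\<close>, which matches the sign of \<open>b\<close>.\<close>
    proof (cases "m = \<bar>b\<bar>")
      case True
      then show ?thesis
        using vertex[of I] be inner_I unfolding e_def by linarith
    next
      case False
      then obtain k where k: "m = \<bar>a $ k\<bar>"
        using m by auto
      define J where "J = (if k \<in> I then I - {k} else insert k I)"
      have J_k: "sign_vec J $ k = - sign_vec I $ k"
        by (simp add: J_def sign_vec_nth)
      have J_i: "sign_vec J $ i = sign_vec I $ i" if "i \<noteq> k" for i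
        using that by (auto simp: J_def sign_vec_nth)
      have "(\<Prod>i\<in>UNIV. sign_vec J $ i) = - e"
        unfolding e_def using J_i by (simp add: prod.remove[of UNIV k] J_k)
      moreover have "a \<bullet> sign_vec J = (\<Sum>i\<in>UNIV. \<bar>a $ i\<bar>) - 2 * m"
        using J_i sgn by (simp add: inner_vec_def sum.remove[of UNIV k] J_k k)
      ultimately show ?thesis
        using vertex[of J] be by simp
    qed
    moreover have "a \<bullet> x + b * w \<le> (\<Sum>i\<in>UNIV. \<bar>a $ i\<bar>) + \<bar>b\<bar> - 2 * m"
    proof -
      \<comment> \<open>Each weight splits as \<open>(\<bar>a $ i\<bar> - m) + m\<close>: the box
        bounds the first part, the second is kept for the facet inequality.\<close>
      have "a \<bullet> x \<le> (\<Sum>i\<in>UNIV. \<bar>a $ i\<bar> - m + m * (sign_vec I $ i * x $ i))"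
        unfolding inner_vec_def
      proof (rule sum_mono)
        fix i
        have "(\<bar>a $ i\<bar> - m) * (sign_vec I $ i * x $ i) \<le> (\<bar>a $ i\<bar> - m) * 1"
          using m_a x[of i] by (intro mult_left_mono) (auto simp: sign_vec_nth abs_le_iff)
        moreover have "\<bar>a $ i\<bar> * (sign_vec I $ i * x $ i) = a $ i * x $ i"
          by (simp add: I_def sign_vec_nth)
        ultimately show "a $ i \<bullet> x $ i \<le> \<bar>a $ i\<bar> - m + m * (sign_vec I $ i * x $ i)"
          by (simp add: left_diff_distrib)
      qed
      also have "\<dots> = (\<Sum>i\<in>UNIV. \<bar>a $ i\<bar>) - real CARD('n) * m + m * (sign_vec I \<bullet> x)"
        by (simp add: sum.distrib sum_subtractf inner_vec_def sum_distrib_left)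
      finally have ax: "a \<bullet> x \<le> \<dots>" .
      have "(\<bar>b\<bar> - m) * (- e * w) \<le> (\<bar>b\<bar> - m) * 1"
        using m_b w e by (intro mult_left_mono) (auto simp: abs_le_iff)
      moreover have "\<bar>b\<bar> * (- e * w) = b * w"
        using be e by auto
      ultimately have bw: "b * w \<le> \<bar>b\<bar> - m - m * (e * w)"
        by (simp add: algebra_simps)
      \<comment> \<open>The kept parts add up to \<open>m\<close> times the facet of
        \<open>I\<close>; its bound \<open>m * (n - 1)\<close> against the \<open>n + 1\<close>
        copies of \<open>m\<close> subtracted so far leaves \<open>- 2 * m\<close>.\<close>
      have "m * (sign_vec I \<bullet> x - e * w) \<le> m * (real CARD('n) - 1)"
        unfolding e_def using facet \<open>m \<ge> 0\<close> by (rule mult_left_mono)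
      with ax bw show ?thesis
        by (simp add: algebra_simps)
    qed
    ultimately show ?thesis
      by linarith
  qed
qed

theorem convex_hull_prod_graph:
  "convex hull (prod_graph :: ((real ^ 'n) \<times> real) set) = box_parity_polytope"
proof
  show "convex hull (prod_graph :: ((real ^ 'n) \<times> real) set) \<subseteq> box_parity_polytope"
    by (simp add: hull_minimal prod_graph_subset_polytope convex_box_parity_polytope)
next
  \<comment> \<open>Finiteness of \<open>V\<close> makes its hull compact, so an outside point can
    be strictly separated from it.\<close>
  define V :: "((real ^ 'n) \<times> real) set"
    where "V = range (\<lambda>I. (sign_vec I, \<Prod>i\<in>UNIV. sign_vec I $ i))"
  have "p \<in> convex hull V" if p: "p \<in> box_parity_polytope" for p
  proof (rule ccontr)
    assume "p \<notin> convex hull V"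
    moreover have "closed (convex hull V)"
      by (simp add: V_def compact_imp_closed compact_convex_hull finite_imp_compact)
    ultimately obtain c d where cd: "c \<bullet> p < d" "\<And>v. v \<in> convex hull V \<Longrightarrow> d < c \<bullet> v"
      using separating_hyperplane_closed_point[of "convex hull V" p] by auto
    obtain a b where c: "c = (a, b)" by fastforce
    obtain x w where xw: "p = (x, w)" by fastforce
    \<comment> \<open>Separation puts \<open>p\<close> on the low side, hence the negated functional
      and the bound \<open>- d\<close>.\<close>
    have "- a \<bullet> sign_vec I + - b * (\<Prod>i\<in>UNIV. sign_vec I $ i) \<le> - d" for I
      using cd(2)[OF hull_inc, of "(sign_vec I, \<Prod>i\<in>UNIV. sign_vec I $ i)"]
      by (simp add: V_def c)
    from polytope_functional_le[OF this] p cd(1) show False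
      by (fastforce simp: c xw)
  qed
  moreover have "convex hull V \<subseteq> convex hull prod_graph"
    by (intro hull_mono) (auto simp: V_def sign_vec_in_prod_graph)
  ultimately show "box_parity_polytope \<subseteq> convex hull (prod_graph :: ((real ^ 'n) \<times> real) set)"
    by blast
qed

text \<open>The sign of the coefficient of \<open>w\<close> splits the family. Where it is -1,
  replacing \<open>I\<close> by \<open>- I\<close> negates \<open>sign_vec I\<close>, and the upper
  bound becomes a lower bound.\<close>

lemma facet_inequalities_iff:
  fixes x :: "real ^ 'n"
  shows "(\<forall>I. sign_vec I \<bullet> x - (\<Prod>i\<in>UNIV. sign_vec I $ i) * w \<le> r) \<longleftrightarrow>
    (\<forall>I. odd (card (- I)) \<longrightarrow> sign_vec I \<bullet> x + w \<le> r) \<and>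
    (\<forall>I. even (card I) \<longrightarrow> - r \<le> sign_vec I \<bullet> x + w)"
    (is "(\<forall>I. ?P I) \<longleftrightarrow> ?R")
proof -
  have "(\<forall>I. ?P I) \<longleftrightarrow> (\<forall>I. odd (card (- I)) \<longrightarrow> ?P I) \<and> (\<forall>I. even (card (- I)) \<longrightarrow> ?P I)"
    by blast
  also have "(\<forall>I. even (card (- I)) \<longrightarrow> ?P I) \<longleftrightarrow> (\<forall>I. even (card I) \<longrightarrow> ?P (- I))"
    by (metis double_complement)
  also have "(\<forall>I. even (card I) \<longrightarrow> ?P (- I)) \<longleftrightarrow>
      (\<forall>I. even (card I) \<longrightarrow> - r \<le> sign_vec I \<bullet> x + w)"
    unfolding prod_sign_vec by (intro all_cong) (auto simp: sign_vec_Compl)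
  also have "(\<forall>I. odd (card (- I)) \<longrightarrow> ?P I) \<longleftrightarrow>
      (\<forall>I. odd (card (- I)) \<longrightarrow> sign_vec I \<bullet> x + w \<le> r)"
    unfolding prod_sign_vec by auto
  finally show ?thesis .
qed

text \<open>Decides where the upper bounds range: over \<open>N_even\<close> for odd n, merging with
  the lower bounds, and over \<open>N_odd\<close> for even n.\<close>

lemma odd_card_Compl:
  fixes I :: "'n::finite set"
  shows "odd (card (- I)) \<longleftrightarrow> (odd (card I) \<longleftrightarrow> even CARD('n))"
proof -
  have "card I + card (- I) = CARD('n)"
    by (metis card_Un_disjoint Compl_partition finite inf_compl_bot)
  then show ?thesis
    by (metis even_add)
qed

theorem theorem4p1:
  shows "(odd CARD('n::finite) \<longrightarrow>
      convex hull (prod_graph :: ((real ^ 'n) \<times> real) set) =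
        {(x, w). (\<forall>i. x $ i \<in> {-1..1}) \<and> w \<in> {-1..1} \<and>
          (\<forall>I\<in>N_even.
             - (real CARD('n) - 1) \<le> (\<Sum>i\<in>I. x $ i) - (\<Sum>i\<in>UNIV - I. x $ i) + w \<and>
             (\<Sum>i\<in>I. x $ i) - (\<Sum>i\<in>UNIV - I. x $ i) + w \<le> real CARD('n) - 1)}) \<and>
    (even CARD('n) \<longrightarrow>
      convex hull (prod_graph :: ((real ^ 'n) \<times> real) set) =
        {(x, w). (\<forall>i. x $ i \<in> {-1..1}) \<and> w \<in> {-1..1} \<and>
          (\<forall>I\<in>N_odd.
             (\<Sum>i\<in>I. x $ i) - (\<Sum>i\<in>UNIV - I. x $ i) + w \<le> real CARD('n) - 1) \<and>
          (\<forall>I\<in>N_even.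
             (\<Sum>i\<in>I. x $ i) - (\<Sum>i\<in>UNIV - I. x $ i) + w \<ge> - (real CARD('n) - 1))})"
  unfolding convex_hull_prod_graph box_parity_polytope_def facet_inequalities_iff
  unfolding odd_card_Compl sign_vec_inner N_even_def N_odd_def
  by auto

end
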